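(* Suppose that $T$ is a tree whose height is an ordinal of uncountable cofinality and all of whose levels have size less than $2^\omega$. Let $\mathbb{P}$ be a forcing poset which is strongly proper on a stationary set and let $\mathbb{Q}$ be an $\omega_1$-closed forcing poset. Then $\mathbb{P} \times \mathbb{Q}$ does not add any new cofinal branches to $T$.
   Context: A forcing poset is $\omega_1$-closed if every countable descending sequence of conditions has a lower bound. For a forcing poset $\mathbb{P}$ and a set $N$ with $N \cap \mathbb{P} \neq \emptyset$, a condition $q$ is strongly $(N,\mathbb{P})$-generic if every dense subset of the forcing poset $N \cap \mathbb{P}$ is predense below $q$. $\mathbb{P}$ is strongly proper for $N$ if every $p \in N \cap \mathbb{P}$ has an extension which is strongly $(N,\mathbb{P})$-generic. $\mathbb{P}$ is strongly proper on a stationary set if for all sufficiently large cardinals $\chi$ with $\mathbb{P} \in H(\chi)$, there are stationarily many $N \in P_{\omega_1}(H(\chi))$ with $N \cap \omega_1 \in \omega_1$ such that $\mathbb{P}$ is strongly proper for $N$. *)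

theory Defs
  imports Main "HOL-Library.Countable_Set"
begin

unbundle cardinal_syntax

section \<open>Trees\<close>

definition pred_order :: "'t set \<Rightarrow> ('t \<Rightarrow> 't \<Rightarrow> bool) \<Rightarrow> 't \<Rightarrow> 't rel" where
  "pred_order T lt t =
     {(x, y). x \<in> T \<and> y \<in> T \<and> lt x t \<and> lt y t \<and> (lt x y \<or> x = y)}"

definition is_tree :: "'t set \<Rightarrow> ('t \<Rightarrow> 't \<Rightarrow> bool) \<Rightarrow> bool" where
  "is_tree T lt \<longleftrightarrow>
     (\<forall>x\<in>T. \<not> lt x x) \<and>
     (\<forall>x\<in>T. \<forall>y\<in>T. \<forall>z\<in>T. lt x y \<longrightarrow> lt y z \<longrightarrow> lt x z) \<and>
     (\<forall>t\<in>T. Well_order (pred_order T lt t))"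

text \<open>
  Ordinals are represented by well-orders (reflexive relations, as in the library), compared up
  to isomorphism. For a well-order \<open>\<delta>\<close>, the ordinals below it are the initial segments
  \<open>seg_ord \<delta> d\<close> with \<open>d \<in> Field \<delta>\<close>.
\<close>

definition seg_ord :: "'d rel \<Rightarrow> 'd \<Rightarrow> 'd rel" where
  "seg_ord \<delta> d = Restr \<delta> (underS \<delta> d)"

definition level :: "'t set \<Rightarrow> ('t \<Rightarrow> 't \<Rightarrow> bool) \<Rightarrow> 'd rel \<Rightarrow> 't set" where
  "level T lt \<alpha> = {t \<in> T. pred_order T lt t =o \<alpha>}"

text \<open>The height is the least ordinal whose level is empty.\<close>

definition has_height :: "'t set \<Rightarrow> ('t \<Rightarrow> 't \<Rightarrow> bool) \<Rightarrow> 'd rel \<Rightarrow> bool" where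
  "has_height T lt \<delta> \<longleftrightarrow>
     Well_order \<delta> \<and> level T lt \<delta> = {} \<and> (\<forall>d\<in>Field \<delta>. level T lt (seg_ord \<delta> d) \<noteq> {})"

text \<open>
  The library constant \<open>cofinal\<close> asks for strict bounds, so a successor ordinal has no cofinal
  set in that sense; the non-strict bound below gives the usual value 1 for successors.
\<close>

definition uncountable_cofinality :: "'d rel \<Rightarrow> bool" where
  "uncountable_cofinality \<delta> \<longleftrightarrow>
     (\<forall>A \<subseteq> Field \<delta>. (\<forall>a\<in>Field \<delta>. \<exists>b\<in>A. (a, b) \<in> \<delta>) \<longrightarrow> uncountable A)"

definition levels_smaller_than_continuum :: "'t set \<Rightarrow> ('t \<Rightarrow> 't \<Rightarrow> bool) \<Rightarrow> 'd rel \<Rightarrow> bool" where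
  "levels_smaller_than_continuum T lt \<delta> \<longleftrightarrow>
     (\<forall>d\<in>Field \<delta>. |level T lt (seg_ord \<delta> d)| <o |UNIV :: nat set set| )"


section \<open>Forcing posets\<close>

text \<open>As usual, \<open>le q p\<close> says that \<open>q\<close> extends \<open>p\<close>; antisymmetry is not required.\<close>

definition forcing_poset :: "'c set \<Rightarrow> ('c \<Rightarrow> 'c \<Rightarrow> bool) \<Rightarrow> bool" where
  "forcing_poset P le \<longleftrightarrow>
     P \<noteq> {} \<and> (\<forall>p\<in>P. le p p) \<and>
     (\<forall>p\<in>P. \<forall>q\<in>P. \<forall>r\<in>P. le p q \<longrightarrow> le q r \<longrightarrow> le p r)"

definition prod_le :: "('p \<Rightarrow> 'p \<Rightarrow> bool) \<Rightarrow> ('q \<Rightarrow> 'q \<Rightarrow> bool) \<Rightarrow> 'p \<times> 'q \<Rightarrow> 'p \<times> 'q \<Rightarrow> bool" where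
  "prod_le leP leQ a b \<longleftrightarrow> leP (fst a) (fst b) \<and> leQ (snd a) (snd b)"

definition omega1_closed :: "'c set \<Rightarrow> ('c \<Rightarrow> 'c \<Rightarrow> bool) \<Rightarrow> bool" where
  "omega1_closed P le \<longleftrightarrow>
     (\<forall>s :: nat \<Rightarrow> 'c. (\<forall>n. s n \<in> P) \<and> (\<forall>n. le (s (Suc n)) (s n)) \<longrightarrow>
        (\<exists>r\<in>P. \<forall>n. le r (s n)))"

definition dense_in :: "'c set \<Rightarrow> ('c \<Rightarrow> 'c \<Rightarrow> bool) \<Rightarrow> 'c set \<Rightarrow> bool" where
  "dense_in P le D \<longleftrightarrow> D \<subseteq> P \<and> (\<forall>p\<in>P. \<exists>d\<in>D. le d p)"

definition compatible :: "'c set \<Rightarrow> ('c \<Rightarrow> 'c \<Rightarrow> bool) \<Rightarrow> 'c \<Rightarrow> 'c \<Rightarrow> bool" where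
  "compatible P le p q \<longleftrightarrow> (\<exists>r\<in>P. le r p \<and> le r q)"

definition predense_below :: "'c set \<Rightarrow> ('c \<Rightarrow> 'c \<Rightarrow> bool) \<Rightarrow> 'c \<Rightarrow> 'c set \<Rightarrow> bool" where
  "predense_below P le q D \<longleftrightarrow> (\<forall>r\<in>P. le r q \<longrightarrow> (\<exists>d\<in>D. compatible P le d r))"

definition strongly_generic :: "'c set \<Rightarrow> 'c set \<Rightarrow> ('c \<Rightarrow> 'c \<Rightarrow> bool) \<Rightarrow> 'c \<Rightarrow> bool" where
  "strongly_generic N P le q \<longleftrightarrow>
     q \<in> P \<and> (\<forall>D. dense_in (N \<inter> P) le D \<longrightarrow> predense_below P le q D)"

definition strongly_proper_for :: "'c set \<Rightarrow> ('c \<Rightarrow> 'c \<Rightarrow> bool) \<Rightarrow> 'c set \<Rightarrow> bool" where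
  "strongly_proper_for P le N \<longleftrightarrow>
     N \<inter> P \<noteq> {} \<and> (\<forall>p\<in>N \<inter> P. \<exists>q\<in>P. le q p \<and> strongly_generic N P le q)"


section \<open>Club and stationary subsets of \<open>P\<^sub>\<omega>\<^sub>1(X)\<close>\<close>

definition countable_subsets :: "'a set \<Rightarrow> 'a set set" where
  "countable_subsets X = {a. a \<subseteq> X \<and> countable a}"

definition club_in :: "'a set \<Rightarrow> 'a set set \<Rightarrow> bool" where
  "club_in X C \<longleftrightarrow>
     C \<subseteq> countable_subsets X \<and>
     (\<forall>a\<in>countable_subsets X. \<exists>c\<in>C. a \<subseteq> c) \<and>
     (\<forall>s :: nat \<Rightarrow> 'a set. (\<forall>n. s n \<in> C) \<and> (\<forall>n. s n \<subseteq> s (Suc n)) \<longrightarrow> (\<Union>n. s n) \<in> C)"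

definition stationary_in :: "'a set \<Rightarrow> 'a set set \<Rightarrow> bool" where
  "stationary_in X S \<longleftrightarrow>
     S \<subseteq> countable_subsets X \<and> (\<forall>C. club_in X C \<longrightarrow> S \<inter> C \<noteq> {})"


section \<open>Hereditarily small sets and \<open>H(\<chi>)\<close>\<close>

text \<open>
  The type \<open>'k hset\<close> is the collection of all pure well-founded sets that are hereditarily of
  cardinality at most \<open>|UNIV :: 'k set|\<close>, i.e. \<open>H(\<kappa>\<^sup>+)\<close> for \<open>\<kappa> = |UNIV :: 'k set|\<close> infinite.
  It is obtained from well-founded trees, \<open>Family f\<close> coding the set whose elements are the
  sets coded by the \<open>f i\<close>, by identifying codes of the same set. The lemmas \<open>hset_eqI\<close>,
  \<open>wf_hmem_rel\<close> and \<open>ex_hset\<close> below characterise it up to isomorphism.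
\<close>

datatype 'k hcode = Empty | Family "'k \<Rightarrow> 'k hcode"

fun members :: "'k hcode \<Rightarrow> 'k hcode set" where
  "members Empty = {}"
| "members (Family f) = range f"

lemma members_induct:
  assumes "\<And>x. (\<And>y. y \<in> members x \<Longrightarrow> Q y) \<Longrightarrow> Q x"
  shows "Q x"
  by (induction x) (auto intro: assms)

inductive code_eq :: "'k hcode \<Rightarrow> 'k hcode \<Rightarrow> bool" where
  code_eqI: "(\<forall>u\<in>members x. \<exists>v\<in>members y. code_eq u v) \<Longrightarrow>
   (\<forall>v\<in>members y. \<exists>u\<in>members x. code_eq u v) \<Longrightarrow> code_eq x y"

lemma code_eq_left: "code_eq x y \<Longrightarrow> u \<in> members x \<Longrightarrow> \<exists>v\<in>members y. code_eq u v"
  and code_eq_right: "code_eq x y \<Longrightarrow> v \<in> members y \<Longrightarrow> \<exists>u\<in>members x. code_eq u v"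
  by (subst (asm) code_eq.simps, blast)+

lemma code_eq_refl: "code_eq x x"
  by (induction x rule: members_induct) (rule code_eqI; blast)

lemma code_eq_sym: "code_eq x y \<Longrightarrow> code_eq y x"
  by (induction rule: code_eq.induct) (rule code_eqI; blast)

lemma code_eq_trans: "code_eq x y \<Longrightarrow> code_eq y z \<Longrightarrow> code_eq x z"
proof (induction x arbitrary: y z rule: members_induct)
  case (1 x)
  show ?case
  proof (rule code_eqI; rule ballI)
    fix u assume u: "u \<in> members x"
    obtain v where v: "v \<in> members y" "code_eq u v"
      using code_eq_left[OF 1(2) u] by blast
    obtain w where "w \<in> members z" "code_eq v w"
      using code_eq_left[OF 1(3) v(1)] by blast
    then show "\<exists>w\<in>members z. code_eq u w"
      using 1(1)[OF u v(2)] by blast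
  next
    fix w assume w: "w \<in> members z"
    obtain v where v: "v \<in> members y" "code_eq v w"
      using code_eq_right[OF 1(3) w] by blast
    obtain u where u: "u \<in> members x" "code_eq u v"
      using code_eq_right[OF 1(2) v(1)] by blast
    then show "\<exists>u\<in>members x. code_eq u w"
      using 1(1)[OF u v(2)] by blast
  qed
qed

quotient_type 'k hset = "'k hcode" / code_eq
  by (intro equivpI reflpI sympI transpI) (fact code_eq_refl, erule code_eq_sym, erule (1) code_eq_trans)

definition code_mem :: "'k hcode \<Rightarrow> 'k hcode \<Rightarrow> bool" where
  "code_mem x y \<longleftrightarrow> (\<exists>v\<in>members y. code_eq x v)"

lift_definition hmem :: "'k hset \<Rightarrow> 'k hset \<Rightarrow> bool" is code_mem
proof -
  have *: "code_mem x' y'" if e: "code_eq x x'" "code_eq y y'" "code_mem x y" for x x' y y' :: "'k hcode"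
  proof -
    obtain v where v: "v \<in> members y" "code_eq x v"
      using e(3) by (auto simp: code_mem_def)
    obtain w where w: "w \<in> members y'" "code_eq v w"
      using code_eq_left[OF e(2) v(1)] by blast
    have "code_eq x' w"
      using code_eq_trans[OF code_eq_sym[OF e(1)] code_eq_trans[OF v(2) w(2)]] .
    then show ?thesis using w(1) by (auto simp: code_mem_def)
  qed
  fix x x' y y' :: "'k hcode"
  assume "code_eq x x'" "code_eq y y'"
  then show "code_mem x y \<longleftrightarrow> code_mem x' y'"
    using * code_eq_sym by blast
qed

definition elts :: "'k hset \<Rightarrow> 'k hset set" where
  "elts x = {y. hmem y x}"

definition hmem_rel :: "'k hset rel" where
  "hmem_rel = {(y, x). y \<in> elts x}"

lemma hset_eqI: "elts x = elts y \<Longrightarrow> x = y"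
proof -
  assume "elts x = elts y"
  then have "\<forall>z. hmem z x \<longleftrightarrow> hmem z y"
    by (auto simp: elts_def)
  then show "x = y"
  proof (transfer)
    fix x y :: "'k hcode"
    assume *: "\<forall>z. code_mem z x \<longleftrightarrow> code_mem z y"
    show "code_eq x y"
    proof (rule code_eqI; rule ballI)
      fix u assume "u \<in> members x"
      then have "code_mem u y"
        using * code_eq_refl[of u] by (auto simp: code_mem_def)
      then show "\<exists>v\<in>members y. code_eq u v" by (simp add: code_mem_def)
    next
      fix v assume "v \<in> members y"
      then have "code_mem v x"
        using * code_eq_refl[of v] unfolding code_mem_def by blast
      then show "\<exists>u\<in>members x. code_eq u v"
        using code_eq_sym by (auto simp: code_mem_def)
    qed
  qed
qed

lemma wf_hmem_rel: "wf (hmem_rel :: 'k hset rel)"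
proof -
  have base: "Q x" if step: "\<And>x. (\<And>y. code_mem y x \<Longrightarrow> Q y) \<Longrightarrow> Q x" for Q and x :: "'k hcode"
  proof -
    have "\<forall>y. code_eq y x \<longrightarrow> Q y"
    proof (induction x rule: members_induct)
      case (1 x)
      show ?case
      proof (intro allI impI, rule step)
        fix y z assume "code_eq y x" "code_mem z y"
        then obtain u where u: "u \<in> members y" "code_eq z u"
          by (auto simp: code_mem_def)
        obtain v where v: "v \<in> members x" "code_eq u v"
          using code_eq_left[OF \<open>code_eq y x\<close> u(1)] by blast
        have "code_eq z v" using code_eq_trans[OF u(2) v(2)] .
        then show "Q z" using 1 v(1) by blast
      qed
    qed
    then show ?thesis using code_eq_refl by blast
  qed
  have ind: "R x" if "\<And>x. (\<And>y. hmem y x \<Longrightarrow> R y) \<Longrightarrow> R x" for R and x :: "'k hset"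
  proof -
    have R: "R (abs_hset c)" for c
    proof (rule base[of "\<lambda>c. R (abs_hset c)"])
      fix c :: "'k hcode"
      assume *: "\<And>d. code_mem d c \<Longrightarrow> R (abs_hset d)"
      show "R (abs_hset c)"
      proof (rule that)
        fix y assume "hmem y (abs_hset c)"
        moreover obtain d where "y = abs_hset d"
          using Quotient_abs_rep[OF Quotient_hset] by metis
        ultimately show "R y"
          using * by (simp add: hmem.abs_eq)
      qed
    qed
    show ?thesis
      using R[of "rep_hset x"] by (simp add: Quotient_abs_rep[OF Quotient_hset])
  qed
  show ?thesis
  proof (rule wfUNIVI)
    fix R :: "'k hset \<Rightarrow> bool" and x
    assume *: "\<forall>x. (\<forall>y. (y, x) \<in> hmem_rel \<longrightarrow> R y) \<longrightarrow> R x"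
    show "R x"
    proof (rule ind)
      fix x assume "\<And>y. hmem y x \<Longrightarrow> R y"
      then show "R x"
        using *[rule_format, of x] by (simp add: hmem_rel_def elts_def)
    qed
  qed
qed

lemma ex_hset: "(\<exists>x :: 'k hset. elts x = A) \<longleftrightarrow> |A| \<le>o |UNIV :: 'k set|"
proof
  assume "\<exists>x :: 'k hset. elts x = A"
  then obtain x :: "'k hset" where x: "elts x = A" by blast
  obtain c where c: "x = abs_hset c"
    using Quotient_abs_rep[OF Quotient_hset] by metis
  have "A \<subseteq> abs_hset ` members c"
  proof
    fix y assume "y \<in> A"
    then have "hmem y (abs_hset c)" using x c by (auto simp: elts_def)
    moreover obtain d where d: "y = abs_hset d"
      using Quotient_abs_rep[OF Quotient_hset] by metis
    ultimately obtain v where "v \<in> members c" "code_eq d v"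
      by (auto simp: hmem.abs_eq code_mem_def)
    then show "y \<in> abs_hset ` members c"
      using d hset.abs_eq_iff by blast
  qed
  then have "|A| \<le>o |members c|"
    by (rule surj_imp_ordLeq)
  moreover have "|members c| \<le>o |UNIV :: 'k set|"
    by (cases c) (auto simp: card_of_image card_of_empty)
  ultimately show "|A| \<le>o |UNIV :: 'k set|"
    using ordLeq_transitive by blast
next
  assume A: "|A| \<le>o |UNIV :: 'k set|"
  obtain c :: "'k hcode" where c: "members c = rep_hset ` A"
  proof (cases "A = {}")
    case True
    then show ?thesis using that[of Empty] by simp
  next
    case False
    then obtain g :: "'k \<Rightarrow> 'k hset" where "g ` UNIV = A"
      using A card_of_ordLeq2[of A "UNIV :: 'k set"] by blast
    then show ?thesis using that[of "Family (\<lambda>k. rep_hset (g k))"] by auto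
  qed
  have "elts (abs_hset c) = A"
  proof (rule set_eqI)
    fix y :: "'k hset"
    have y: "y = abs_hset (rep_hset y)"
      using Quotient_abs_rep[OF Quotient_hset] by metis
    have "y \<in> elts (abs_hset c) \<longleftrightarrow> code_mem (rep_hset y) c"
      by (subst y) (simp add: elts_def hmem.abs_eq)
    also have "\<dots> \<longleftrightarrow> (\<exists>a\<in>A. code_eq (rep_hset y) (rep_hset a))"
      using c by (simp add: code_mem_def)
    also have "\<dots> \<longleftrightarrow> (\<exists>a\<in>A. y = a)"
      by (simp add: Quotient_rel_rep[OF Quotient_hset])
    finally show "y \<in> elts (abs_hset c) \<longleftrightarrow> y \<in> A"
      by simp
  qed
  then show "\<exists>x :: 'k hset. elts x = A" by blast
qed

definition trcl :: "'k hset \<Rightarrow> 'k hset set" where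
  "trcl x = {y. (y, x) \<in> hmem_rel\<^sup>+}"

text \<open>This is the true \<open>H(\<chi>)\<close> for every infinite cardinal \<open>\<chi> \<le> |UNIV :: 'k set|\<close>.\<close>

definition H :: "'k rel \<Rightarrow> 'k hset set" where
  "H \<chi> = {x. |trcl x| <o \<chi>}"

definition transitive_hset :: "'k hset \<Rightarrow> bool" where
  "transitive_hset x \<longleftrightarrow> (\<forall>y\<in>elts x. elts y \<subseteq> elts x)"

definition von_Neumann_ordinal :: "'k hset \<Rightarrow> bool" where
  "von_Neumann_ordinal x \<longleftrightarrow> transitive_hset x \<and> (\<forall>y\<in>elts x. transitive_hset y)"

definition omega1 :: "'k hset set" where
  "omega1 = {\<alpha>. von_Neumann_ordinal \<alpha> \<and> countable (elts \<alpha>)}"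

text \<open>
  Here \<open>\<chi>\<close> ranges over the cardinals up to \<open>|UNIV :: 'k set|\<close>, with \<open>'k\<close> arbitrary. Requiring
  \<open>P \<in> H \<chi>\<^sub>0\<close> for the threshold \<open>\<chi>\<^sub>0\<close> makes sure that \<open>'k\<close> is large enough for the condition
  not to hold vacuously.
\<close>

definition strongly_proper_on_stationary_set :: "'k hset \<Rightarrow> ('k hset \<Rightarrow> 'k hset \<Rightarrow> bool) \<Rightarrow> bool" where
  "strongly_proper_on_stationary_set P le \<longleftrightarrow>
     (\<exists>\<chi>\<^sub>0 :: 'k rel. Card_order \<chi>\<^sub>0 \<and> natLeq <o \<chi>\<^sub>0 \<and> P \<in> H \<chi>\<^sub>0 \<and>
        (\<forall>\<chi> :: 'k rel. Card_order \<chi> \<and> \<chi>\<^sub>0 \<le>o \<chi> \<and> P \<in> H \<chi> \<longrightarrow>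
           stationary_in (H \<chi>)
             {N \<in> countable_subsets (H \<chi>).
                (\<exists>\<beta>\<in>omega1. N \<inter> omega1 = elts \<beta>) \<and> strongly_proper_for (elts P) le N}))"


section \<open>The forcing relation\<close>

text \<open>
  A statement of the forcing language is represented by the set of conditions forcing it; the
  connectives and the quantifiers over ground model sets are the clauses of the usual
  definition of the forcing relation.
\<close>

type_synonym 'c fprop = "'c \<Rightarrow> bool"

definition dense_below :: "'c set \<Rightarrow> ('c \<Rightarrow> 'c \<Rightarrow> bool) \<Rightarrow> 'c \<Rightarrow> 'c set \<Rightarrow> bool" where
  "dense_below P le p D \<longleftrightarrow> (\<forall>q\<in>P. le q p \<longrightarrow> (\<exists>r\<in>D. r \<in> P \<and> le r q))"

text \<open>Statements about ground model objects that are absolute.\<close>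

definition f_ground :: "bool \<Rightarrow> 'c fprop" where
  "f_ground A p \<longleftrightarrow> A"

definition f_not :: "'c set \<Rightarrow> ('c \<Rightarrow> 'c \<Rightarrow> bool) \<Rightarrow> 'c fprop \<Rightarrow> 'c fprop" where
  "f_not P le \<phi> p \<longleftrightarrow> (\<forall>q\<in>P. le q p \<longrightarrow> \<not> \<phi> q)"

definition f_and :: "'c fprop \<Rightarrow> 'c fprop \<Rightarrow> 'c fprop" where
  "f_and \<phi> \<psi> p \<longleftrightarrow> \<phi> p \<and> \<psi> p"

definition f_imp :: "'c set \<Rightarrow> ('c \<Rightarrow> 'c \<Rightarrow> bool) \<Rightarrow> 'c fprop \<Rightarrow> 'c fprop \<Rightarrow> 'c fprop" where
  "f_imp P le \<phi> \<psi> p \<longleftrightarrow> \<not> (\<exists>q\<in>P. le q p \<and> \<phi> q \<and> f_not P le \<psi> q)"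

definition f_all :: "'x set \<Rightarrow> ('x \<Rightarrow> 'c fprop) \<Rightarrow> 'c fprop" where
  "f_all A \<phi> p \<longleftrightarrow> (\<forall>x\<in>A. \<phi> x p)"

definition f_ex :: "'c set \<Rightarrow> ('c \<Rightarrow> 'c \<Rightarrow> bool) \<Rightarrow> 'x set \<Rightarrow> ('x \<Rightarrow> 'c fprop) \<Rightarrow> 'c fprop" where
  "f_ex P le A \<phi> p \<longleftrightarrow> dense_below P le p {q. \<exists>x\<in>A. \<phi> x q}"

text \<open>
  A name for a subset of a ground model set \<open>T\<close> is a set \<open>b \<subseteq> T \<times> P\<close>, which evaluates to
  \<open>{t. \<exists>r\<in>G. (t, r) \<in> b}\<close> for a generic filter \<open>G\<close>; every subset of \<open>T\<close> in the extension has
  such a name.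
\<close>

definition f_mem :: "'c set \<Rightarrow> ('c \<Rightarrow> 'c \<Rightarrow> bool) \<Rightarrow> 't \<Rightarrow> ('t \<times> 'c) set \<Rightarrow> 'c fprop" where
  "f_mem P le t b p \<longleftrightarrow> dense_below P le p {q. \<exists>r. (t, r) \<in> b \<and> le q r}"

definition f_in_ground :: "'c set \<Rightarrow> ('c \<Rightarrow> 'c \<Rightarrow> bool) \<Rightarrow> 't set \<Rightarrow> ('t \<times> 'c) set \<Rightarrow> 'c fprop" where
  "f_in_ground P le T b =
     f_ex P le (Pow T) (\<lambda>B. f_all T (\<lambda>t.
       f_and (f_imp P le (f_mem P le t b) (f_ground (t \<in> B)))
             (f_imp P le (f_ground (t \<in> B)) (f_mem P le t b))))"

definition comparable :: "('t \<Rightarrow> 't \<Rightarrow> bool) \<Rightarrow> 't \<Rightarrow> 't \<Rightarrow> bool" where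
  "comparable lt s t \<longleftrightarrow> lt s t \<or> s = t \<or> lt t s"

text \<open>
  The subset \<open>b\<close> of \<open>T\<close> is a branch (a maximal chain) which meets every level below the height
  \<open>\<delta>\<close>. The levels of \<open>T\<close> are the same in the ground model and in the extension.
\<close>

definition f_cofinal_branch ::
  "'c set \<Rightarrow> ('c \<Rightarrow> 'c \<Rightarrow> bool) \<Rightarrow> 't set \<Rightarrow> ('t \<Rightarrow> 't \<Rightarrow> bool) \<Rightarrow> 'd rel \<Rightarrow> ('t \<times> 'c) set \<Rightarrow> 'c fprop" where
  "f_cofinal_branch P le T lt \<delta> b =
     f_and
       (f_all T (\<lambda>s. f_all T (\<lambda>t.
          f_imp P le (f_and (f_mem P le s b) (f_mem P le t b)) (f_ground (comparable lt s t)))))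
    (f_and
       (f_all T (\<lambda>t.
          f_imp P le (f_all T (\<lambda>s. f_imp P le (f_mem P le s b) (f_ground (comparable lt s t))))
            (f_mem P le t b)))
       (f_all (Field \<delta>) (\<lambda>d.
          f_ex P le (level T lt (seg_ord \<delta> d)) (\<lambda>t. f_mem P le t b))))"

definition adds_no_new_cofinal_branches ::
  "'c set \<Rightarrow> ('c \<Rightarrow> 'c \<Rightarrow> bool) \<Rightarrow> 't set \<Rightarrow> ('t \<Rightarrow> 't \<Rightarrow> bool) \<Rightarrow> 'd rel \<Rightarrow> bool" where
  "adds_no_new_cofinal_branches P le T lt \<delta> \<longleftrightarrow>
     (\<forall>b \<subseteq> T \<times> P. \<forall>p\<in>P. f_imp P le (f_cofinal_branch P le T lt \<delta> b) (f_in_ground P le T b) p)"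

end

theory Submission
  imports Defs
begin

text \<open>
  Suppose \<open>(p\<^sub>0, q\<^sub>0)\<close> forces \<open>b\<close> to be a new cofinal branch. Any two conditions below \<open>(p\<^sub>0, q\<^sub>0)\<close>
  have extensions forcing incomparable nodes into \<open>b\<close>. Take a countable \<open>N\<close>, closed under a function
  choosing such extensions, for which \<open>P\<close> is strongly proper, and put \<open>M = N \<inter> P\<close>. Build a tree
  \<open>(q\<^sub>s)\<close>, \<open>s \<in> 2\<^sup><\<^sup>\<omega>\<close>, of conditions in \<open>Q\<close> such that for distinct \<open>f, g \<in> 2\<^sup>\<omega>\<close> and every \<open>u \<in> M\<close> compatible
  with \<open>p\<^sub>0\<close> there are \<open>v, v' \<le> u\<close> in \<open>M\<close> and \<open>n\<close> such that \<open>(v, q\<^bsub>f|n\<^esub>)\<close> and \<open>(v', q\<^bsub>g|n\<^esub>)\<close> force incomparable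
  nodes into \<open>b\<close>. The countably many nodes involved lie below some level \<open>d\<close>.

  Let \<open>p \<le> p\<^sub>0\<close> be strongly generic and let \<open>q\<^sub>f\<close> be a lower bound along \<open>f\<close>. Some \<open>(r\<^sub>f, x\<^sub>f) \<le> (p, q\<^sub>f)\<close>
  decides the node \<open>t\<^sub>f\<close> of \<open>b\<close> on level \<open>d\<close>, and by strong genericity \<open>r\<^sub>f\<close> has a residue
  \<open>m\<^sub>f \<in> M\<close>: every extension of \<open>m\<^sub>f\<close> in \<open>M\<close> is compatible with \<open>r\<^sub>f\<close>. Since \<open>M\<close> is countable and the
  level is smaller than the continuum, \<open>m\<^sub>f = m\<^sub>g\<close> and \<open>t\<^sub>f = t\<^sub>g\<close> for some \<open>f \<noteq> g\<close>. Splitting at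
  \<open>u = m\<^sub>f\<close> then puts two incomparable nodes below \<open>t\<^sub>f\<close>.
\<close>

section \<open>Trees: ranks of nodes and comparability\<close>

lemma pred_order_Field: "Field (pred_order T lt t) = {s \<in> T. lt s t}"
  by (auto simp: Field_def pred_order_def)

text \<open>Transitivity of \<open>lt\<close> makes the predecessors of \<open>s\<close> an initial
  segment of those of \<open>t\<close>, so the tree order turns into comparison of ordinals.\<close>

lemma pred_order_underS:
  assumes tree: "is_tree T lt" and T: "s \<in> T" "t \<in> T" and st: "lt s t"
  shows "pred_order T lt s = Restr (pred_order T lt t) (underS (pred_order T lt t) s)"
  using assms unfolding is_tree_def underS_def pred_order_def by blast

lemma pred_order_mono:
  assumes tree: "is_tree T lt" and T: "s \<in> T" "t \<in> T" and st: "lt s t"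
  shows "pred_order T lt s <o pred_order T lt t"
proof -
  have wo: "Well_order (pred_order T lt t)"
    using tree T by (simp add: is_tree_def)
  have "s \<in> Field (pred_order T lt t)"
    using assms by (simp add: pred_order_Field)
  then show ?thesis
    using underS_Restr_ordLess[OF wo] pred_order_underS[OF assms] by fastforce
qed

text \<open>If the predecessors of \<open>t\<close> had order type at least \<delta>, then
  \<open>t\<close> or one of its predecessors would lie on level \<delta>, which is empty.\<close>

lemma node_level:
  assumes tree: "is_tree T lt" and height: "has_height T lt \<delta>" and t: "t \<in> T"
  shows "\<exists>d\<in>Field \<delta>. t \<in> level T lt (seg_ord \<delta> d)"
proof -
  have wo: "Well_order (pred_order T lt t)" and wo': "Well_order \<delta>"
    using tree height t by (simp_all add: is_tree_def has_height_def)
  have "\<not> \<delta> \<le>o pred_order T lt t"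
  proof
    assume "\<delta> \<le>o pred_order T lt t"
    then consider "\<delta> <o pred_order T lt t" | "\<delta> =o pred_order T lt t"
      using ordLeq_iff_ordLess_or_ordIso by blast
    then show False
    proof cases
      case 1
      then obtain s where s: "s \<in> Field (pred_order T lt t)"
        "\<delta> =o Restr (pred_order T lt t) (underS (pred_order T lt t) s)"
        using ordLess_iff_ordIso_Restr[OF wo wo'] by blast
      then have "s \<in> T" "lt s t"
        using tree by (auto simp: pred_order_Field)
      then have "pred_order T lt s =o \<delta>"
        using s pred_order_underS[OF tree] t ordIso_symmetric by metis
      then show False
        using height \<open>s \<in> T\<close> by (auto simp: has_height_def level_def)
    next
      case 2
      then show False
        using height t ordIso_symmetric by (auto simp: has_height_def level_def)
    qed
  qed
  then have "pred_order T lt t <o \<delta>"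
    using wo wo' not_ordLeq_iff_ordLess by blast
  then show ?thesis
    using ordLess_iff_ordIso_Restr[OF wo' wo] t by (auto simp: level_def seg_ord_def)
qed

lemma seg_ord_mono:
  assumes wo: "Well_order \<delta>" and "(d, e) \<in> \<delta>"
  shows "seg_ord \<delta> d \<le>o seg_ord \<delta> e"
proof -
  have trans: "trans \<delta>" and antisym: "antisym \<delta>"
    using wo by (simp_all add: well_order_on_def linear_order_on_def partial_order_on_def preorder_on_def)
  have "underS \<delta> d \<subseteq> underS \<delta> e"
    using underS_incr[OF trans antisym assms(2)] .
  moreover have "wo_rel.ofilter \<delta> (underS \<delta> d)" "wo_rel.ofilter \<delta> (underS \<delta> e)"
    using wo by (simp_all add: wo_rel_def wo_rel.underS_ofilter)
  ultimately show ?thesis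
    using ofilter_subset_ordLeq[OF wo] unfolding seg_ord_def by blast
qed

text \<open>The alternative \<open>lt t s\<close> would give \<open>t\<close> a strictly smaller
  rank than \<open>s\<close>, against \<open>(d, e) \<in> \<delta>\<close>.\<close>

lemma comparable_levels:
  assumes tree: "is_tree T lt" and wo: "Well_order \<delta>"
    and s: "s \<in> level T lt (seg_ord \<delta> d)" and t: "t \<in> level T lt (seg_ord \<delta> e)"
    and de: "(d, e) \<in> \<delta>" and cmp: "comparable lt s t"
  shows "s = t \<or> lt s t"
proof (rule ccontr)
  assume "\<not> ?thesis"
  then have "lt t s"
    using cmp by (auto simp: comparable_def)
  then have "pred_order T lt t <o pred_order T lt s"
    using s t pred_order_mono[OF tree] by (simp add: level_def)
  moreover have "pred_order T lt s \<le>o pred_order T lt t"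
    using s t seg_ord_mono[OF wo de] unfolding level_def
    by (metis (mono_tags, lifting) mem_Collect_eq ordIso_ordLeq_trans ordIso_symmetric ordLeq_ordIso_trans)
  ultimately show False
    using not_ordLess_ordLeq by blast
qed

lemma comparable_below:
  assumes tree: "is_tree T lt" and T: "r \<in> T" "s \<in> T" "t \<in> T"
    and "r = t \<or> lt r t" "s = t \<or> lt s t"
  shows "comparable lt r s"
proof (cases "r = t \<or> s = t")
  case True
  then show ?thesis using assms by (auto simp: comparable_def)
next
  case False
  then have F: "r \<in> Field (pred_order T lt t)" "s \<in> Field (pred_order T lt t)"
    using assms by (auto simp: pred_order_Field)
  have "Well_order (pred_order T lt t)"
    using tree T by (simp add: is_tree_def)
  then have "Total (pred_order T lt t)"
    by (simp add: well_order_on_def linear_order_on_def)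
  then show ?thesis
    using F by (auto simp: total_on_def comparable_def pred_order_def)
qed

text \<open>A countable set is not cofinal, so some \<open>a\<close> lies below none of its members;
  totality makes this \<open>a\<close> an upper bound.\<close>

lemma countable_bounded:
  assumes wo: "Well_order \<delta>" and cof: "uncountable_cofinality \<delta>"
    and A: "A \<subseteq> Field \<delta>" "countable A"
  shows "\<exists>a\<in>Field \<delta>. \<forall>d\<in>A. (d, a) \<in> \<delta>"
proof -
  have "\<not> (\<forall>a\<in>Field \<delta>. \<exists>d\<in>A. (a, d) \<in> \<delta>)"
    using cof[unfolded uncountable_cofinality_def, rule_format, of A] A by metis
  then obtain a where a: "a \<in> Field \<delta>" "\<forall>d\<in>A. (a, d) \<notin> \<delta>"
    by blast
  have tot: "Total \<delta>" and "Refl \<delta>"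
    using wo by (simp_all add: well_order_on_def linear_order_on_def partial_order_on_def preorder_on_def)
  have "(d, a) \<in> \<delta>" if "d \<in> A" for d
  proof -
    have "d \<noteq> a" using a that \<open>Refl \<delta>\<close> by (auto simp: refl_on_def)
    then show ?thesis using tot a that A by (auto simp: total_on_def)
  qed
  then show ?thesis using a by blast
qed

section \<open>Consequences of forcing a new cofinal branch\<close>

locale forced_new_branch =
  fixes C :: "'c set" and le :: "'c \<Rightarrow> 'c \<Rightarrow> bool" and T :: "'t set" and lt :: "'t \<Rightarrow> 't \<Rightarrow> bool"
    and \<delta> :: "'d rel" and b :: "('t \<times> 'c) set" and c :: 'c
  assumes tree: "is_tree T lt" and height: "has_height T lt \<delta>"
    and poset: "forcing_poset C le"
    and c: "c \<in> C"
    and branch: "f_cofinal_branch C le T lt \<delta> b c"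
    and new: "f_not C le (f_in_ground C le T b) c"
begin

abbreviation "forces_mem t p \<equiv> f_mem C le t b p"

lemma wo: "Well_order \<delta>"
  using height by (simp add: has_height_def)

lemma le_refl: "p \<in> C \<Longrightarrow> le p p"
  and le_trans: "le p q \<Longrightarrow> le q r \<Longrightarrow> p \<in> C \<Longrightarrow> q \<in> C \<Longrightarrow> r \<in> C \<Longrightarrow> le p r"
  using poset unfolding forcing_poset_def by blast+

lemma forces_mem_mono:
  assumes "forces_mem t p" "le q p" "p \<in> C" "q \<in> C"
  shows "forces_mem t q"
  using assms le_trans unfolding f_mem_def dense_below_def by blast

lemma forces_mem_comparable:
  assumes "s \<in> T" "t \<in> T" "p \<in> C" "le p c" "forces_mem s p" "forces_mem t p"
  shows "comparable lt s t"
  using branch assms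
  unfolding f_cofinal_branch_def f_and_def f_all_def f_imp_def f_not_def f_ground_def by blast

lemma forces_mem_level:
  assumes "d \<in> Field \<delta>" "p \<in> C" "le p c"
  shows "\<exists>q\<in>C. le q p \<and> (\<exists>t\<in>level T lt (seg_ord \<delta> d). forces_mem t q)"
  using branch assms
  unfolding f_cofinal_branch_def f_and_def f_all_def f_ex_def dense_below_def by blast

text \<open>This is maximality of the branch: as \<open>p\<close> forces \<open>t\<close> out of
  \<open>b\<close>, it cannot force every node of \<open>b\<close> to be comparable with
  \<open>t\<close>, so an extension of \<open>p\<close> forces a counterexample into
  \<open>b\<close>.\<close>

lemma forced_not_mem:
  assumes t: "t \<in> T" and p: "p \<in> C" "le p c" and "f_not C le (f_mem C le t b) p"
  shows "\<exists>s\<in>T. \<exists>q\<in>C. le q p \<and> forces_mem s q \<and> \<not> comparable lt s t"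
proof -
  have "f_imp C le (f_all T (\<lambda>s. f_imp C le (f_mem C le s b) (f_ground (comparable lt s t))))
      (f_mem C le t b) c"
    using branch t unfolding f_cofinal_branch_def f_and_def f_all_def[of T] by blast
  then have "\<not> f_all T (\<lambda>s. f_imp C le (f_mem C le s b) (f_ground (comparable lt s t))) p"
    using assms by (subst (asm) f_imp_def) blast
  then show ?thesis
    using le_refl unfolding f_all_def f_imp_def f_not_def f_ground_def by blast
qed

definition possible :: "'c \<Rightarrow> 't set" where
  "possible p = {t \<in> T. \<exists>q\<in>C. le q p \<and> forces_mem t q}"

text \<open>If the possible nodes formed a chain, that chain would be the branch, so it would lie in the ground model.\<close>

lemma possible_not_chain:
  assumes p: "p \<in> C" "le p c"
  shows "\<exists>s\<in>possible p. \<exists>t\<in>possible p. \<not> comparable lt s t"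
proof (rule ccontr)
  assume chain: "\<not> ?thesis"
  have "f_in_ground C le T b p"
    unfolding f_in_ground_def f_ex_def dense_below_def
  proof (intro ballI impI)
    fix q assume q: "q \<in> C" "le q p"
    have up: "r \<in> C \<Longrightarrow> le r q \<Longrightarrow> le r p" "r \<in> C \<Longrightarrow> le r q \<Longrightarrow> le r c" for r
      using q p c le_trans by blast+
    have "f_imp C le (f_mem C le t b) (f_ground (t \<in> possible p)) q" if "t \<in> T" for t
      unfolding f_imp_def f_not_def f_ground_def
      using that up le_refl unfolding possible_def by blast
    \<comment> \<open>A possible node forced out of \<open>b\<close> would be incomparable with a
      node that some extension forces into \<open>b\<close>; that node is possible too, against the
      chain assumption.\<close>
    moreover have "f_imp C le (f_ground (t \<in> possible p)) (f_mem C le t b) q" if t: "t \<in> T" for t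
      unfolding f_imp_def f_ground_def
    proof clarify
      fix r assume r: "r \<in> C" "le r q" "t \<in> possible p" "f_not C le (f_mem C le t b) r"
      then obtain s r' where "s \<in> T" "r' \<in> C" "le r' r" "forces_mem s r'" "\<not> comparable lt s t"
        using forced_not_mem[OF t r(1) up(2)] by blast
      moreover from this have "s \<in> possible p"
        using r up p le_trans unfolding possible_def by blast
      ultimately show False using chain r by blast
    qed
    moreover have "possible p \<in> Pow T"
      by (auto simp: possible_def)
    ultimately show "\<exists>r\<in>{q. \<exists>B\<in>Pow T. f_all T (\<lambda>t. f_and
        (f_imp C le (f_mem C le t b) (f_ground (t \<in> B)))
        (f_imp C le (f_ground (t \<in> B)) (f_mem C le t b))) q}. r \<in> C \<and> le r q"
      using q le_refl unfolding f_all_def f_and_def by blast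
  qed
  then show False
    using new p unfolding f_not_def by blast
qed

text \<open>Two incomparable nodes are possible below \<open>p\<close>. Extend \<open>q\<close> to
  decide the node \<open>t\<close> of \<open>b\<close> on a level \<open>e\<close> at least as high
  as both. Nodes below \<open>t\<close> are comparable, so \<open>t\<close> is incomparable with one
  of the two, and \<open>p\<close> is extended to force that one.\<close>

lemma split_conditions:
  assumes p: "p \<in> C" "le p c" and q: "q \<in> C" "le q c"
  shows "\<exists>p'\<in>C. \<exists>q'\<in>C. \<exists>s\<in>T. \<exists>t\<in>T. le p' p \<and> le q' q \<and>
    forces_mem s p' \<and> forces_mem t q' \<and> \<not> comparable lt s t"
proof -
  obtain s s' where s: "s \<in> possible p" "s' \<in> possible p" "\<not> comparable lt s s'"
    using possible_not_chain[OF p] by blast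
  then have sT: "s \<in> T" "s' \<in> T" by (auto simp: possible_def)
  obtain d d' where d: "d \<in> Field \<delta>" "s \<in> level T lt (seg_ord \<delta> d)"
    and d': "d' \<in> Field \<delta>" "s' \<in> level T lt (seg_ord \<delta> d')"
    using node_level[OF tree height] sT by meson
  obtain e where e: "e \<in> Field \<delta>" "(d, e) \<in> \<delta>" "(d', e) \<in> \<delta>"
  proof -
    interpret wo_rel \<delta> using wo by (simp add: wo_rel_def)
    show ?thesis using that d d' TOTALS REFL by metis
  qed
  obtain q' t where t: "q' \<in> C" "le q' q" "t \<in> level T lt (seg_ord \<delta> e)" "forces_mem t q'"
    using forces_mem_level[OF e(1) q] by blast
  then have tT: "t \<in> T" by (simp add: level_def)
  have "\<not> comparable lt s t \<or> \<not> comparable lt s' t"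
    using comparable_levels[OF tree wo d(2) t(3) e(2)] comparable_levels[OF tree wo d'(2) t(3) e(3)]
      comparable_below[OF tree sT tT] s(3) by blast
  then show ?thesis
    using s t tT unfolding possible_def by blast
qed

end

section \<open>Finitary closure and stationary sets\<close>

inductive_set ternary_closure :: "('z \<Rightarrow> 'z \<Rightarrow> 'z \<Rightarrow> 'z set) \<Rightarrow> 'z set \<Rightarrow> 'z set"
  for f :: "'z \<Rightarrow> 'z \<Rightarrow> 'z \<Rightarrow> 'z set" and A :: "'z set" where
  base: "a \<in> A \<Longrightarrow> a \<in> ternary_closure f A"
| step: "x \<in> ternary_closure f A \<Longrightarrow> y \<in> ternary_closure f A \<Longrightarrow> z \<in> ternary_closure f A \<Longrightarrow>
    w \<in> f x y z \<Longrightarrow> w \<in> ternary_closure f A"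

lemma ternary_closure_least:
  assumes "A \<subseteq> B" and "\<And>x y z. x \<in> B \<Longrightarrow> y \<in> B \<Longrightarrow> z \<in> B \<Longrightarrow> f x y z \<subseteq> B"
  shows "ternary_closure f A \<subseteq> B"
proof
  fix w assume "w \<in> ternary_closure f A"
  then show "w \<in> B"
    by induction (use assms in blast)+
qed

lemma ternary_closure_mono: "A \<subseteq> B \<Longrightarrow> ternary_closure f A \<subseteq> ternary_closure f B"
  by (rule ternary_closure_least) (auto intro: ternary_closure.intros)

text \<open>The iterates of the one-step extension \<open>g\<close> are countable and increasing.
  Any three arguments from their union occur at a common stage, so the union is closed.\<close>

lemma countable_ternary_closure:
  assumes A: "countable A" and f: "\<And>x y z. countable (f x y z)"
  shows "countable (ternary_closure f A)"
proof -
  define g where "g S = S \<union> (\<Union>x\<in>S. \<Union>y\<in>S. \<Union>z\<in>S. f x y z)" for S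
  have mono: "(g ^^ m) A \<subseteq> (g ^^ n) A" if "m \<le> n" for m n
    using that by (rule lift_Suc_mono_le[rotated]) (auto simp: g_def)
  have "countable ((g ^^ n) A)" for n
    by (induction n) (auto simp: A f g_def)
  moreover have "ternary_closure f A \<subseteq> (\<Union>n. (g ^^ n) A)"
  proof (rule ternary_closure_least)
    show "A \<subseteq> (\<Union>n. (g ^^ n) A)"
      using UN_upper[of 0 UNIV "\<lambda>n. (g ^^ n) A"] by simp
  next
    fix x y z
    assume "x \<in> (\<Union>n. (g ^^ n) A)" "y \<in> (\<Union>n. (g ^^ n) A)" "z \<in> (\<Union>n. (g ^^ n) A)"
    then obtain i j k where "x \<in> (g ^^ i) A" "y \<in> (g ^^ j) A" "z \<in> (g ^^ k) A"
      by blast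
    then have "x \<in> (g ^^ (i + j + k)) A" "y \<in> (g ^^ (i + j + k)) A" "z \<in> (g ^^ (i + j + k)) A"
      using mono[of i "i + j + k"] mono[of j "i + j + k"] mono[of k "i + j + k"] by auto
    then have "f x y z \<subseteq> (g ^^ Suc (i + j + k)) A"
      by (auto simp: g_def)
    then show "f x y z \<subseteq> (\<Union>n. (g ^^ n) A)"
      by blast
  qed
  ultimately show ?thesis
    by (meson countable_UN countable_subset countableI_type)
qed

text \<open>Three arguments again occur at a common stage. This gives closure under countable
  increasing unions for the club built below.\<close>

lemma ternary_closure_UN_chain:
  fixes S :: "nat \<Rightarrow> 'z set"
  assumes chain: "\<And>n. S n \<subseteq> S (Suc n)"
  shows "ternary_closure f (\<Union>n. S n) \<subseteq> (\<Union>n. ternary_closure f (S n))"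
proof (rule ternary_closure_least)
  show "(\<Union>n. S n) \<subseteq> (\<Union>n. ternary_closure f (S n))"
    by (auto intro: ternary_closure.base)
next
  have mono: "ternary_closure f (S m) \<subseteq> ternary_closure f (S n)" if "m \<le> n" for m n
    using that chain by (intro ternary_closure_mono) (rule lift_Suc_mono_le)
  fix x y z
  assume "x \<in> (\<Union>n. ternary_closure f (S n))" "y \<in> (\<Union>n. ternary_closure f (S n))"
    "z \<in> (\<Union>n. ternary_closure f (S n))"
  then obtain i j k where "x \<in> ternary_closure f (S i)" "y \<in> ternary_closure f (S j)"
      "z \<in> ternary_closure f (S k)"
    by blast
  then have "x \<in> ternary_closure f (S (i + j + k))" "y \<in> ternary_closure f (S (i + j + k))"
      "z \<in> ternary_closure f (S (i + j + k))"
    using mono[of i "i + j + k"] mono[of j "i + j + k"] mono[of k "i + j + k"] by auto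
  then have "f x y z \<subseteq> ternary_closure f (S (i + j + k))"
    by (auto intro: ternary_closure.step)
  then show "f x y z \<subseteq> (\<Union>n. ternary_closure f (S n))"
    by blast
qed

text \<open>
  The second sort \<open>Q\<close> need not embed into \<open>Y\<close>. The pairs closed under the operations are
  therefore projected to \<open>Y\<close>; as the operations are finitary, the projection contains a club.
\<close>

lemma stationary_closed_pair:
  fixes Y E :: "'e set" and Q :: "'q set"
  assumes S: "stationary_in Y S" and EY: "E \<subseteq> Y" and e: "e \<in> E" and q: "q \<in> Q"
    and fE: "\<And>u x y. u \<in> E \<Longrightarrow> x \<in> Q \<Longrightarrow> y \<in> Q \<Longrightarrow> fE u x y \<in> countable_subsets E"
    and fQ: "\<And>u x y. u \<in> E \<Longrightarrow> x \<in> Q \<Longrightarrow> y \<in> Q \<Longrightarrow> fQ u x y \<in> countable_subsets Q"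
  shows "\<exists>N\<in>S. \<exists>X\<in>countable_subsets Q. e \<in> N \<and> q \<in> X \<and>
    (\<forall>u\<in>N \<inter> E. \<forall>x\<in>X. \<forall>y\<in>X. fE u x y \<subseteq> N \<and> fQ u x y \<subseteq> X)"
proof -
  \<comment> \<open>The sum type joins the two sorts. A single set-valued operation codes both
    \<open>fE\<close> and \<open>fQ\<close>; it is empty on arguments of the wrong sort or outside
    \<open>E\<close> and \<open>Q\<close>.\<close>
  define f :: "'e + 'q \<Rightarrow> 'e + 'q \<Rightarrow> 'e + 'q \<Rightarrow> ('e + 'q) set" where
    "f a b c = (case (a, b, c) of (Inl u, Inr x, Inr y) \<Rightarrow>
       if u \<in> E \<and> x \<in> Q \<and> y \<in> Q then Inl ` fE u x y \<union> Inr ` fQ u x y else {} | _ \<Rightarrow> {})" for a b c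
  \<comment> \<open>Only \<open>N \<inter> E\<close> generates: \<open>N\<close> may contain
    elements of \<open>Y\<close> on which the operations have no meaning.\<close>
  define A where "A N = insert (Inr q) (Inl ` (N \<inter> E))" for N
  define K where "K N = ternary_closure f (A N)" for N
  define C where "C = {N \<in> countable_subsets Y. e \<in> N \<and> (\<forall>w. Inl w \<in> K N \<longrightarrow> w \<in> N)}"
  have f_sub: "f a b c \<subseteq> Inl ` E \<union> Inr ` Q" for a b c
    using fE fQ unfolding f_def countable_subsets_def
    by (cases a; cases b; cases c) (simp_all, blast?)
  have f_count: "countable (f a b c)" for a b c
    using fE fQ unfolding f_def countable_subsets_def
    by (cases a; cases b; cases c) simp_all
  have K_sub: "K N \<subseteq> Inl ` E \<union> Inr ` Q" for N
    unfolding K_def by (rule ternary_closure_least) (use f_sub q in \<open>auto simp: A_def\<close>)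
  have K_count: "countable (K N)" if "countable N" for N
    unfolding K_def using that f_count
    by (intro countable_ternary_closure) (auto simp: A_def)
  have vimage_count: "countable {w. i w \<in> S}" if "inj i" "countable S" for i :: "'x \<Rightarrow> 'e + 'q" and S
    using that countable_subset[of "i ` {w. i w \<in> S}" S] countable_image_inj_on[of i "{w. i w \<in> S}"]
    by (auto intro: inj_on_subset)
  have "club_in Y C"
    unfolding club_in_def
  proof (intro conjI ballI allI impI)
    show "C \<subseteq> countable_subsets Y" by (auto simp: C_def)
  next
    fix a assume a: "a \<in> countable_subsets Y"
    \<comment> \<open>Closing once is enough: \<open>M\<close> adds only first-sort elements of
      \<open>K (insert e a)\<close>, so \<open>K M\<close> contains nothing beyond
      \<open>K (insert e a)\<close>.\<close>
    define M where "M = insert e a \<union> {w. Inl w \<in> K (insert e a)}"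
    have "A M \<subseteq> K (insert e a)"
      by (auto simp: A_def M_def K_def intro: ternary_closure.base)
    then have "K M \<subseteq> K (insert e a)"
      unfolding K_def by (rule ternary_closure_least) (auto intro: ternary_closure.step)
    moreover have "countable {w. Inl w \<in> K (insert e a)}"
      using a K_count[of "insert e a"] by (intro vimage_count) (auto simp: countable_subsets_def)
    moreover have "M \<subseteq> Y"
      using a e EY K_sub[of "insert e a"] by (auto simp: M_def countable_subsets_def)
    ultimately have "M \<in> C"
      using a by (auto simp: C_def M_def countable_subsets_def)
    then show "\<exists>c\<in>C. a \<subseteq> c"
      by (rule bexI[rotated]) (auto simp: M_def)
  next
    fix s :: "nat \<Rightarrow> 'e set"
    assume s: "(\<forall>n. s n \<in> C) \<and> (\<forall>n. s n \<subseteq> s (Suc n))"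
    have "A (\<Union>n. s n) = (\<Union>n. A (s n))"
      by (auto simp: A_def)
    then have "K (\<Union>n. s n) \<subseteq> (\<Union>n. K (s n))"
      unfolding K_def using s
      by (simp only:) (rule ternary_closure_UN_chain, unfold A_def, blast)
    then show "(\<Union>n. s n) \<in> C"
      using s by (auto simp: C_def countable_subsets_def) blast
  qed
  then obtain N where N: "N \<in> S" "N \<in> C"
    using S by (auto simp: stationary_in_def)
  \<comment> \<open>Membership in \<open>C\<close> keeps the first-sort part of \<open>K N\<close>
    inside \<open>N\<close>; the second-sort part serves as \<open>X\<close>.\<close>
  define X where "X = {x. Inr x \<in> K N}"
  have "countable X"
    unfolding X_def using N K_count by (intro vimage_count) (auto simp: C_def countable_subsets_def)
  moreover have "X \<subseteq> Q"
    using K_sub[of N] by (auto simp: X_def)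
  moreover have "q \<in> X"
    by (auto simp: X_def K_def A_def intro: ternary_closure.base)
  moreover have "fE u x y \<subseteq> N \<and> fQ u x y \<subseteq> X" if u: "u \<in> N \<inter> E" and xy: "x \<in> X" "y \<in> X" for u x y
  proof -
    have "Inl u \<in> K N"
      using u by (auto simp: K_def A_def intro: ternary_closure.base)
    moreover have "Inr x \<in> K N" "Inr y \<in> K N"
      using xy by (auto simp: X_def)
    ultimately have "f (Inl u) (Inr x) (Inr y) \<subseteq> K N"
      unfolding K_def by (auto intro: ternary_closure.step)
    then have "Inl ` fE u x y \<union> Inr ` fQ u x y \<subseteq> K N"
      using u xy \<open>X \<subseteq> Q\<close> by (auto simp: f_def subset_iff)
    then show ?thesis
      using N by (auto simp: C_def X_def)
  qed
  ultimately show ?thesis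
    using N unfolding C_def countable_subsets_def
    by (intro bexI[of _ N] bexI[of _ X] conjI ballI) blast+
qed

section \<open>Binary trees of conditions\<close>

text \<open>The pairs are treated one at a time; by \<open>mono\<close>, pairs already in relation
  \<open>R\<close> stay so when their entries are extended further.\<close>

lemma split_finitely_many_pairs:
  fixes g :: "'i \<Rightarrow> 'q"
  assumes refl: "\<And>x. x \<in> X \<Longrightarrow> le x x"
    and trans: "\<And>x y z. x \<in> X \<Longrightarrow> y \<in> X \<Longrightarrow> z \<in> X \<Longrightarrow> le x y \<Longrightarrow> le y z \<Longrightarrow> le x z"
    and mono: "\<And>x y x' y'. x \<in> X \<Longrightarrow> y \<in> X \<Longrightarrow> x' \<in> X \<Longrightarrow> y' \<in> X \<Longrightarrow> R x y \<Longrightarrow>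
      le x' x \<Longrightarrow> le y' y \<Longrightarrow> R x' y'"
    and split: "\<And>x y. x \<in> X \<Longrightarrow> y \<in> X \<Longrightarrow> \<exists>x'\<in>X. \<exists>y'\<in>X. le x' x \<and> le y' y \<and> R x' y'"
    and "finite J" "\<forall>(i, j)\<in>J. i \<noteq> j" "range g \<subseteq> X"
  shows "\<exists>g'. range g' \<subseteq> X \<and> (\<forall>i. le (g' i) (g i)) \<and> (\<forall>(i, j)\<in>J. R (g' i) (g' j))"
  using assms(5,6)
proof (induction J)
  case empty
  then show ?case using \<open>range g \<subseteq> X\<close> refl by (intro exI[of _ g]) auto
next
  case (insert p J)
  obtain i j where p: "p = (i, j)" "i \<noteq> j"
    using insert.prems by auto
  obtain g' where g': "range g' \<subseteq> X" "\<forall>i. le (g' i) (g i)" "\<forall>(i, j)\<in>J. R (g' i) (g' j)"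
    using insert by auto
  obtain x y where xy: "x \<in> X" "y \<in> X" "le x (g' i)" "le y (g' j)" "R x y"
    using split[of "g' i" "g' j"] g'(1) by blast
  \<comment> \<open>The two updates do not collide because \<open>i \<noteq> j\<close>.\<close>
  define h where "h = g'(i := x, j := y)"
  have h: "range h \<subseteq> X" "\<And>k. le (h k) (g' k)"
    using g' xy refl by (auto simp: h_def)
  have "le (h k) (g k)" for k
    using trans[of "h k" "g' k" "g k"] h g' \<open>range g \<subseteq> X\<close> by (auto simp: subset_iff)
  moreover have "R (h k) (h l)" if "(k, l) \<in> J" for k l
    using mono[of "g' k" "g' l" "h k" "h l"] h g' that by (auto simp: subset_iff)
  moreover have "R (h i) (h j)"
    using xy p by (simp add: h_def)
  ultimately show ?case
    using h p by (intro exI[of _ h]) auto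
qed

text \<open>Sets of naturals code the branches. Stage \<open>Suc n\<close> extends the conditions of
  stage \<open>n\<close> and puts every pair of distinct subsets of \<open>{..n}\<close> into
  relation \<open>R n\<close>; there are only finitely many such pairs.\<close>

lemma perfect_tree_of_conditions:
  fixes R :: "nat \<Rightarrow> 'q \<Rightarrow> 'q \<Rightarrow> bool"
  assumes refl: "\<And>x. x \<in> X \<Longrightarrow> le x x"
    and trans: "\<And>x y z. x \<in> X \<Longrightarrow> y \<in> X \<Longrightarrow> z \<in> X \<Longrightarrow> le x y \<Longrightarrow> le y z \<Longrightarrow> le x z"
    and mono: "\<And>n x y x' y'. x \<in> X \<Longrightarrow> y \<in> X \<Longrightarrow> x' \<in> X \<Longrightarrow> y' \<in> X \<Longrightarrow> R n x y \<Longrightarrow>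
      le x' x \<Longrightarrow> le y' y \<Longrightarrow> R n x' y'"
    and split: "\<And>n x y. x \<in> X \<Longrightarrow> y \<in> X \<Longrightarrow> \<exists>x'\<in>X. \<exists>y'\<in>X. le x' x \<and> le y' y \<and> R n x' y'"
    and ne: "X \<noteq> {}"
  shows "\<exists>g :: nat \<Rightarrow> nat set \<Rightarrow> 'q. (\<forall>n Z. g n Z \<in> X \<and> le (g (Suc n) Z) (g n Z)) \<and>
    (\<forall>n Z W. Z \<inter> {..n} \<noteq> W \<inter> {..n} \<longrightarrow> R n (g (Suc n) Z) (g (Suc n) W))"
proof -
  have "\<exists>h. \<forall>n. range (h n) \<subseteq> X \<and> ((\<forall>Z. le (h (Suc n) Z) (h n (Z \<inter> {..<n}))) \<and>
    (\<forall>Z\<in>Pow {..n}. \<forall>W\<in>Pow {..n}. Z \<noteq> W \<longrightarrow> R n (h (Suc n) Z) (h (Suc n) W)))"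
  proof (rule dependent_nat_choice)
    show "\<exists>h :: nat set \<Rightarrow> 'q. range h \<subseteq> X"
      using ne by (auto intro: exI[of _ "\<lambda>_. SOME x. x \<in> X"] some_in_eq[THEN iffD2])
  next
    fix h :: "nat set \<Rightarrow> 'q" and n :: nat assume "range h \<subseteq> X"
    define J where "J = Pow {..n} \<times> Pow {..n} - Id"
    have J: "finite J" "\<forall>(i, j)\<in>J. i \<noteq> j"
      unfolding J_def by (intro finite_Diff finite_cartesian_product) auto
    have "range (\<lambda>Z. h (Z \<inter> {..<n})) \<subseteq> X"
      using \<open>range h \<subseteq> X\<close> by auto
    have "\<exists>h'. range h' \<subseteq> X \<and> (\<forall>Z. le (h' Z) (h (Z \<inter> {..<n}))) \<and> (\<forall>(i, j)\<in>J. R n (h' i) (h' j))"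
      by (rule split_finitely_many_pairs[where R = "R n" and X = X and le = le];
          fact refl trans mono split J \<open>range (\<lambda>Z. h (Z \<inter> {..<n})) \<subseteq> X\<close>)
    then obtain h' where "range h' \<subseteq> X" "\<forall>i. le (h' i) (h (i \<inter> {..<n}))"
        "\<forall>(i, j)\<in>J. R n (h' i) (h' j)"
      by (elim exE conjE)
    then show "\<exists>h'. range h' \<subseteq> X \<and> (\<forall>Z. le (h' Z) (h (Z \<inter> {..<n}))) \<and>
        (\<forall>Z\<in>Pow {..n}. \<forall>W\<in>Pow {..n}. Z \<noteq> W \<longrightarrow> R n (h' Z) (h' W))"
      by (intro exI[of _ h']) (auto simp: J_def)
  qed
  then obtain h where h': "\<forall>n. range (h n) \<subseteq> X \<and> ((\<forall>Z. le (h (Suc n) Z) (h n (Z \<inter> {..<n}))) \<and>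
      (\<forall>Z\<in>Pow {..n}. \<forall>W\<in>Pow {..n}. Z \<noteq> W \<longrightarrow> R n (h (Suc n) Z) (h (Suc n) W)))" ..
  have h: "h n Z \<in> X" "le (h (Suc n) Z) (h n (Z \<inter> {..<n}))"
    "Z \<subseteq> {..n} \<Longrightarrow> W \<subseteq> {..n} \<Longrightarrow> Z \<noteq> W \<Longrightarrow> R n (h (Suc n) Z) (h (Suc n) W)" for n Z W
    using h'[rule_format, of n] by (simp_all add: image_subset_iff)
  \<comment> \<open>The final \<open>g n Z\<close> is \<open>h n (Z \<inter> {..<n})\<close>, so
    that \<open>g (Suc n) Z\<close> depends exactly on \<open>Z \<inter> {..n}\<close>.\<close>
  have "Z \<inter> {..<Suc n} \<inter> {..<n} = Z \<inter> {..<n}" for Z n by auto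
  then have "le (h (Suc n) (Z \<inter> {..<Suc n})) (h n (Z \<inter> {..<n}))" for n Z
    using h(2)[of n "Z \<inter> {..<Suc n}"] by metis
  then show ?thesis
    using h by (intro exI[of _ "\<lambda>n Z. h n (Z \<inter> {..<n})"]) (auto simp: lessThan_Suc_atMost)
qed

section \<open>Residues, a pigeonhole principle and elements of \<open>H \<chi>\<close>\<close>

text \<open>Otherwise the members of \<open>N \<inter> E\<close> incompatible with \<open>r\<close>
  would be dense in \<open>N \<inter> E\<close>, hence predense below \<open>p\<close>, and one of
  them would be compatible with \<open>r\<close>.\<close>

lemma ex_residue:
  assumes sg: "strongly_generic N E le p" and r: "r \<in> E" "le r p"
  shows "\<exists>u\<in>N \<inter> E. \<forall>v\<in>N \<inter> E. le v u \<longrightarrow> compatible E le v r"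
proof (rule ccontr)
  assume "\<not> ?thesis"
  then have "dense_in (N \<inter> E) le {v \<in> N \<inter> E. \<not> compatible E le v r}"
    unfolding dense_in_def by blast
  then have "predense_below E le p {v \<in> N \<inter> E. \<not> compatible E le v r}"
    using sg unfolding strongly_generic_def by blast
  then show False
    using r unfolding predense_below_def by blast
qed

text \<open>The product \<open>M \<times> L\<close> is smaller than the continuum: it is countable
  if \<open>L\<close> is finite and of size at most \<open>|L|\<close> otherwise. So
  \<open>h\<close> cannot be injective.\<close>

lemma ex_equal_values_continuum:
  fixes h :: "nat set \<Rightarrow> 'm \<times> 'l"
  assumes M: "countable M" and L: "|L| <o |UNIV :: nat set set|" and h: "range h \<subseteq> M \<times> L"
  shows "\<exists>Z W. Z \<noteq> W \<and> h Z = h W"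
proof (rule ccontr)
  assume "\<not> ?thesis"
  then have "inj h" by (auto simp: inj_def)
  then have le: "|UNIV :: nat set set| \<le>o |M \<times> L|"
    using h card_of_ordLeq by blast
  have M': "|M| \<le>o |UNIV :: nat set|"
    using M by (auto simp: countable_def card_of_ordLeq[symmetric])
  show False
  proof (cases "finite L")
    case True
    then have "countable (M \<times> L)"
      using M by (simp add: countable_finite)
    then have "countable (UNIV :: nat set set)"
      using \<open>inj h\<close> h by (metis countable_image_inj_on countable_subset)
    then have "range (from_nat_into (UNIV :: nat set set)) = Pow UNIV"
      by (simp add: range_from_nat_into)
    then show False
      using Cantors_theorem by blast
  next
    case False
    then have "|M| \<le>o |L|"
      using M' infinite_iff_card_of_nat ordLeq_transitive by blast
    moreover have "M \<noteq> {}"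
      using h by auto
    ultimately have "|M \<times> L| \<le>o |L|"
      using False card_of_Times_infinite ordIso_imp_ordLeq by metis
    then show False
      using le L ordLeq_transitive not_ordLess_ordLeq by blast
  qed
qed

text \<open>Needed to view the conditions of \<open>P\<close> as elements of the set whose countable
  subsets the stationarity hypothesis speaks of.\<close>

lemma H_elts: "P \<in> H \<chi> \<Longrightarrow> elts P \<subseteq> H \<chi>"
proof
  fix y assume P: "P \<in> H \<chi>" and y: "y \<in> elts P"
  have "trcl y \<subseteq> trcl P"
    using y by (auto simp: trcl_def hmem_rel_def intro: trancl_into_trancl)
  then have "|trcl y| \<le>o |trcl P|"
    by (rule card_of_mono1)
  then show "y \<in> H \<chi>"
    using P ordLeq_ordLess_trans by (auto simp: H_def)
qed

section \<open>No new cofinal branches in the product extension\<close>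

theorem theorem2p6:
  fixes T :: "'t set" and lt :: "'t \<Rightarrow> 't \<Rightarrow> bool" and \<delta> :: "'d rel"
    and P :: "'k hset" and leP :: "'k hset \<Rightarrow> 'k hset \<Rightarrow> bool"
    and Q :: "'q set" and leQ :: "'q \<Rightarrow> 'q \<Rightarrow> bool"
  assumes "is_tree T lt"
    and "has_height T lt \<delta>"
    and "uncountable_cofinality \<delta>"
    and "levels_smaller_than_continuum T lt \<delta>"
    and "forcing_poset (elts P) leP"
    and "strongly_proper_on_stationary_set P leP"
    and "forcing_poset Q leQ"
    and "omega1_closed Q leQ"
  shows "adds_no_new_cofinal_branches (elts P \<times> Q) (prod_le leP leQ) T lt \<delta>"
  unfolding adds_no_new_cofinal_branches_def
proof (intro allI impI ballI)
  define E where "E = elts P"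
  fix b :: "('t \<times> ('k hset \<times> 'q)) set" and a
  show "f_imp (elts P \<times> Q) (prod_le leP leQ)
      (f_cofinal_branch (elts P \<times> Q) (prod_le leP leQ) T lt \<delta> b)
      (f_in_ground (elts P \<times> Q) (prod_le leP leQ) T b) a"
    unfolding f_imp_def E_def[symmetric]
  proof clarify
    fix p0 q0
    assume p0: "p0 \<in> E" and q0: "q0 \<in> Q"
      and branch: "f_cofinal_branch (E \<times> Q) (prod_le leP leQ) T lt \<delta> b (p0, q0)"
      and new: "f_not (E \<times> Q) (prod_le leP leQ) (f_in_ground (E \<times> Q) (prod_le leP leQ) T b) (p0, q0)"
    have E: "forcing_poset E leP" using assms by (simp add: E_def)
    have P_refl: "p \<in> E \<Longrightarrow> leP p p"
      and P_trans: "p \<in> E \<Longrightarrow> q \<in> E \<Longrightarrow> r \<in> E \<Longrightarrow> leP p q \<Longrightarrow> leP q r \<Longrightarrow> leP p r" for p q r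
      using E unfolding forcing_poset_def by blast+
    have Q_refl: "p \<in> Q \<Longrightarrow> leQ p p"
      and Q_trans: "p \<in> Q \<Longrightarrow> q \<in> Q \<Longrightarrow> r \<in> Q \<Longrightarrow> leQ p q \<Longrightarrow> leQ q r \<Longrightarrow> leQ p r" for p q r
      using assms(7) unfolding forcing_poset_def by blast+
    have poset: "forcing_poset (E \<times> Q) (prod_le leP leQ)"
      unfolding forcing_poset_def
    proof (intro conjI ballI impI)
      show "E \<times> Q \<noteq> {}" using p0 q0 by blast
      show "prod_le leP leQ x x" if "x \<in> E \<times> Q" for x
        using that P_refl Q_refl by (auto simp: prod_le_def)
      show "prod_le leP leQ x z" if "x \<in> E \<times> Q" "y \<in> E \<times> Q" "z \<in> E \<times> Q"
        "prod_le leP leQ x y" "prod_le leP leQ y z" for x y z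
        using that P_trans[of "fst x" "fst y" "fst z"] Q_trans[of "snd x" "snd y" "snd z"]
        by (auto simp: prod_le_def)
    qed
    interpret forced_new_branch "E \<times> Q" "prod_le leP leQ" T lt \<delta> b "(p0, q0)"
      using assms poset p0 q0 branch new by unfold_locales auto

    \<comment> \<open>Choosing splittings below \<open>(p0, q0)\<close>\<close>
    define Q0 where "Q0 = {x \<in> Q. leQ x q0}"
    have Q0: "x \<in> Q0 \<Longrightarrow> x \<in> Q" "x \<in> Q0 \<Longrightarrow> leQ x q0" for x by (auto simp: Q0_def)
    have Q0_down: "x \<in> Q0" if "x \<in> Q" "leQ x y" "y \<in> Q0" for x y
      using that Q_trans[of x y q0] q0 by (simp add: Q0_def)
    have mem_mono: "forces_mem t (p', x')"
      if "forces_mem t (p, x)" "p \<in> E" "p' \<in> E" "x \<in> Q" "x' \<in> Q" "leP p' p" "leQ x' x" for t p p' x x'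
      using forces_mem_mono[OF that(1)] that by (simp add: prod_le_def)
    \<comment> \<open>On the \<open>Q\<close> side all conditions are kept below \<open>q0\<close>.
      On the \<open>P\<close> side \<open>u\<close> will only be compatible with \<open>p0\<close>,
      since a residue need not lie below \<open>p0\<close>.\<close>
    define splits where "splits u x y w \<longleftrightarrow> (case w of (v, v', x', y', s, t) \<Rightarrow>
      v \<in> E \<and> v' \<in> E \<and> leP v u \<and> leP v' u \<and> x' \<in> Q0 \<and> y' \<in> Q0 \<and> leQ x' x \<and> leQ y' y \<and>
      s \<in> T \<and> t \<in> T \<and> forces_mem s (v, x') \<and> forces_mem t (v', y') \<and> \<not> comparable lt s t)"
      for u x y w
    have ex_splits: "\<exists>w. splits u x y w"
      if u: "u \<in> E" "compatible E leP u p0" and xy: "x \<in> Q0" "y \<in> Q0" for u x y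
    proof -
      \<comment> \<open>Splitting applies only below \<open>(p0, q0)\<close>, so it is performed at
        a common extension \<open>u'\<close> of \<open>u\<close> and \<open>p0\<close>.\<close>
      obtain u' where u': "u' \<in> E" "leP u' u" "leP u' p0"
        using u by (auto simp: compatible_def)
      then obtain v x' v' y' s t where w: "v \<in> E" "v' \<in> E" "x' \<in> Q" "y' \<in> Q" "s \<in> T" "t \<in> T"
          "leP v u'" "leP v' u'" "leQ x' x" "leQ y' y"
          "forces_mem s (v, x')" "forces_mem t (v', y')" "\<not> comparable lt s t"
        using split_conditions[of "(u', x)" "(u', y)"] xy Q0 by (auto simp: prod_le_def)
      then have "splits u x y (v, v', x', y', s, t)"
        using u(1) u'(1,2) xy Q0_down[of x' x] Q0_down[of y' y] P_trans[of v u' u] P_trans[of v' u' u]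
        by (simp add: splits_def)
      then show ?thesis ..
    qed
    define w where "w u x y = (SOME w. splits u x y w)" for u x y
    \<comment> \<open>If \<open>u\<close> is incompatible with \<open>p0\<close>, the chosen
      \<open>w u x y\<close> is arbitrary; the empty default keeps the operations within
      \<open>E\<close>, \<open>Q0\<close> and \<open>T\<close>.\<close>
    define fE where "fE u x y = (case w u x y of (v, v', x', y', s, t) \<Rightarrow>
      if compatible E leP u p0 then {v, v'} else {})" for u x y
    define fQ where "fQ u x y = (case w u x y of (v, v', x', y', s, t) \<Rightarrow>
      if compatible E leP u p0 then {x', y'} else {})" for u x y
    define fT where "fT u x y = (case w u x y of (v, v', x', y', s, t) \<Rightarrow>
      if compatible E leP u p0 then {s, t} else {})" for u x y
    have w: "splits u x y (w u x y)"
      if "u \<in> E" "compatible E leP u p0" "x \<in> Q0" "y \<in> Q0" for u x y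
      unfolding w_def using ex_splits[OF that] by (rule someI_ex)
    have fE: "fE u x y \<in> countable_subsets E" and fQ: "fQ u x y \<in> countable_subsets Q0"
      and fT: "fT u x y \<in> countable_subsets T" if "u \<in> E" "x \<in> Q0" "y \<in> Q0" for u x y
      using w[OF that(1) _ that(2,3)]
      by (auto simp: splits_def fE_def fQ_def fT_def countable_subsets_def split: prod.splits)

    \<comment> \<open>The countable sets \<open>N\<close> and \<open>X\<close> and a level bounding
      the nodes involved\<close>
    obtain \<chi> :: "'k rel" where \<chi>: "P \<in> H \<chi>"
      "stationary_in (H \<chi>) {N \<in> countable_subsets (H \<chi>).
         (\<exists>\<beta>\<in>omega1. N \<inter> omega1 = elts \<beta>) \<and> strongly_proper_for (elts P) leP N}"
      using assms(6) unfolding strongly_proper_on_stationary_set_def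
      using card_order_on_well_order_on ordLeq_reflexive by blast
    have EH: "E \<subseteq> H \<chi>" using H_elts \<chi> by (simp add: E_def)
    have q0': "q0 \<in> Q0" using q0 Q_refl by (simp add: Q0_def)
    obtain N X where "N \<in> {N \<in> countable_subsets (H \<chi>).
         (\<exists>\<beta>\<in>omega1. N \<inter> omega1 = elts \<beta>) \<and> strongly_proper_for (elts P) leP N}"
      and "X \<in> countable_subsets Q0" and N0: "p0 \<in> N" and X0: "q0 \<in> X"
      and closed: "\<forall>u\<in>N \<inter> E. \<forall>x\<in>X. \<forall>y\<in>X. fE u x y \<subseteq> N \<and> fQ u x y \<subseteq> X"
      using stationary_closed_pair[where fE = fE and fQ = fQ, OF \<chi>(2) EH p0 q0' fE fQ] by blast
    then have N: "countable N" "strongly_proper_for E leP N" and X: "countable X" "X \<subseteq> Q0"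
      by (simp_all add: countable_subsets_def E_def)
    define M where "M = N \<inter> E"
    have M: "countable M" "M \<subseteq> E" "p0 \<in> M" using N N0 p0 by (auto simp: M_def)
    define T0 where "T0 = (\<Union>u\<in>M. \<Union>x\<in>X. \<Union>y\<in>X. fT u x y)"
    have fT': "fT u x y \<in> countable_subsets T" if "u \<in> M" "x \<in> X" "y \<in> X" for u x y
      using fT[of u x y] that M X by blast
    have T0: "countable T0" "T0 \<subseteq> T"
      unfolding T0_def using M X fT' by (intro countable_UN UN_least; simp add: countable_subsets_def)+
    obtain rank where rank: "\<And>t. t \<in> T \<Longrightarrow> rank t \<in> Field \<delta> \<and> t \<in> level T lt (seg_ord \<delta> (rank t))"
      using node_level[OF tree height] by metis
    \<comment> \<open>Uncountable cofinality gives one level \<open>d\<close> at or above all nodes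
      of \<open>T0\<close>, before any branch through the tree of conditions is considered.\<close>
    obtain d where d: "d \<in> Field \<delta>" "\<And>t. t \<in> T0 \<Longrightarrow> (rank t, d) \<in> \<delta>"
      using countable_bounded[OF wo assms(3), of "rank ` T0"] T0 rank
      by (metis (no_types, lifting) countable_image image_eqI image_subsetI subsetD)

    \<comment> \<open>A tree of conditions in \<open>Q\<close> indexed by sets of naturals\<close>
    define u where "u n = from_nat_into M (fst (prod_decode n))" for n
    have u_M: "u n \<in> M" for n using M by (auto simp: u_def intro: from_nat_into)
    \<comment> \<open>Every member of \<open>M\<close> recurs at arbitrarily late stages, so two
      branches can still be split at it after they have separated.\<close>
    have u_inf: "\<exists>n\<ge>k. u n = m" if m: "m \<in> M" for m k
    proof -
      obtain i where "from_nat_into M i = m"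
        using from_nat_into_surj[OF M(1) m] by blast
      then show ?thesis
        using le_prod_encode_2[of k i] by (intro exI[of _ "prod_encode (i, k)"]) (simp add: u_def)
    qed
    define R where "R n x y \<longleftrightarrow> (compatible E leP (u n) p0 \<longrightarrow>
      (\<exists>v\<in>M. \<exists>v'\<in>M. \<exists>s\<in>T0. \<exists>t\<in>T0. leP v (u n) \<and> leP v' (u n) \<and>
        forces_mem s (v, x) \<and> forces_mem t (v', y) \<and> \<not> comparable lt s t))" for n x y
    have "\<exists>g :: nat \<Rightarrow> nat set \<Rightarrow> 'q. (\<forall>n Z. g n Z \<in> X \<and> leQ (g (Suc n) Z) (g n Z)) \<and>
      (\<forall>n Z W. Z \<inter> {..n} \<noteq> W \<inter> {..n} \<longrightarrow> R n (g (Suc n) Z) (g (Suc n) W))"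
    proof (rule perfect_tree_of_conditions)
      show "leQ x x" if "x \<in> X" for x using that X Q0 Q_refl by blast
      show "leQ x z" if "x \<in> X" "y \<in> X" "z \<in> X" "leQ x y" "leQ y z" for x y z
        using that X Q0 Q_trans by blast
      show "R n x' y'" if "x \<in> X" "y \<in> X" "x' \<in> X" "y' \<in> X" "R n x y" "leQ x' x" "leQ y' y"
        for n x y x' y'
      proof -
        have "x \<in> Q" "y \<in> Q" "x' \<in> Q" "y' \<in> Q" using that X Q0 by blast+
        then show ?thesis
          using that(5-7) M(2) mem_mono P_refl unfolding R_def by (meson subsetD)
      qed
      show "\<exists>x'\<in>X. \<exists>y'\<in>X. leQ x' x \<and> leQ y' y \<and> R n x' y'" if xy: "x \<in> X" "y \<in> X" for n x y
      proof (cases "compatible E leP (u n) p0")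
        case True
        obtain v v' x' y' s t where w': "w (u n) x y = (v, v', x', y', s, t)"
          by (metis prod_cases6)
        have sp: "splits (u n) x y (v, v', x', y', s, t)"
          using w[of "u n" x y] w' True xy X M u_M by auto
        \<comment> \<open>Closure of \<open>N\<close> and \<open>X\<close> under the chosen
          operations keeps the splitting inside \<open>M\<close> and \<open>X\<close>.\<close>
        have "v \<in> N" "v' \<in> N" "x' \<in> X" "y' \<in> X"
          using closed[rule_format, of "u n" x y] u_M[of n] xy True w' by (auto simp: M_def fE_def fQ_def)
        moreover have "fT (u n) x y \<subseteq> T0"
          unfolding T0_def using u_M[of n] xy by blast
        then have "s \<in> T0" "t \<in> T0"
          using True w' by (auto simp: fT_def)
        moreover have "v \<in> M" "v' \<in> M"
          using calculation sp by (auto simp: M_def splits_def)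
        ultimately show ?thesis
          using sp unfolding splits_def prod.case R_def by blast
      next
        case False
        then show ?thesis
          using xy X Q0 Q_refl unfolding R_def by blast
      qed
      show "X \<noteq> {}" using X0 by blast
    qed
    then obtain g :: "nat \<Rightarrow> nat set \<Rightarrow> 'q" where g: "\<And>n Z. g n Z \<in> X"
        "\<And>n Z. leQ (g (Suc n) Z) (g n Z)"
      and gR: "\<And>n Z W. Z \<inter> {..n} \<noteq> W \<inter> {..n} \<Longrightarrow> R n (g (Suc n) Z) (g (Suc n) W)"
      by blast
    have gQ: "g n Z \<in> Q" for n Z using g X Q0 by blast

    \<comment> \<open>A node of level \<open>d\<close> and a residue for each branch\<close>
    obtain p where p: "p \<in> E" "leP p p0" "strongly_generic N E leP p"
      using N N0 p0 unfolding strongly_proper_for_def by blast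
    have "\<exists>r x t m. r \<in> E \<and> leP r p \<and> x \<in> Q \<and> (\<forall>n. leQ x (g n Z)) \<and>
        t \<in> level T lt (seg_ord \<delta> d) \<and> forces_mem t (r, x) \<and>
        m \<in> M \<and> (\<forall>v\<in>M. leP v m \<longrightarrow> compatible E leP v r)" for Z
    proof -
      obtain y where y: "y \<in> Q" "\<And>n. leQ y (g n Z)"
        using assms(8)[unfolded omega1_closed_def, rule_format, of "\<lambda>n. g n Z"] gQ g(2) by blast
      have "leQ y q0"
        using Q_trans[OF y(1) gQ q0 y(2)[of 0]] Q0 g X by blast
      then obtain r x t where r: "r \<in> E" "x \<in> Q" "leP r p" "leQ x y"
          "t \<in> level T lt (seg_ord \<delta> d)" "forces_mem t (r, x)"
        using forces_mem_level[OF d(1), of "(p, y)"] p y by (auto simp: prod_le_def)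
      moreover have "leQ x (g n Z)" for n
        using Q_trans[OF r(2) y(1) gQ r(4) y(2)] .
      moreover obtain m where "m \<in> M" "\<forall>v\<in>M. leP v m \<longrightarrow> compatible E leP v r"
        using ex_residue[OF p(3) r(1,3)] unfolding M_def by blast
      ultimately show ?thesis by blast
    qed
    then obtain r x t m where r: "\<And>Z. r Z \<in> E" "\<And>Z. leP (r Z) p"
      and x: "\<And>Z. x Z \<in> Q" "\<And>Z n. leQ (x Z) (g n Z)"
      and t: "\<And>Z. t Z \<in> level T lt (seg_ord \<delta> d)" "\<And>Z. forces_mem (t Z) (r Z, x Z)"
      and m: "\<And>Z. m Z \<in> M" "\<And>Z v. v \<in> M \<Longrightarrow> leP v (m Z) \<Longrightarrow> compatible E leP v (r Z)"
      by metis
    \<comment> \<open>The residue property gives a common extension \<open>r'\<close> of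
      \<open>v\<close> and \<open>r Z\<close>. Then \<open>(r', x Z)\<close> forces both
      \<open>s\<close> and \<open>t Z\<close> into \<open>b\<close>, and the rank of
      \<open>s\<close> is at most \<open>d\<close>.\<close>
    have below: "s = t Z \<or> lt s (t Z)"
      if s: "s \<in> T0" and v: "v \<in> M" "leP v (m Z)" "forces_mem s (v, g n Z)" for s v Z n
    proof -
      obtain r' where r': "r' \<in> E" "leP r' v" "leP r' (r Z)"
        using m(2)[OF v(1,2)] by (auto simp: compatible_def)
      have "v \<in> E" using v M by blast
      have "forces_mem s (r', x Z)"
        using mem_mono[OF v(3) \<open>v \<in> E\<close> r'(1) gQ x(1) r'(2) x(2)] .
      moreover have "forces_mem (t Z) (r', x Z)"
        using mem_mono[OF t(2) r(1) r'(1) x(1) x(1) r'(3) Q_refl[OF x(1)]] .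
      moreover have "leP r' p0"
        using P_trans r' r p p0 by meson
      moreover have "leQ (x Z) q0"
        using Q_trans[OF x(1) gQ q0 x(2)[of Z 0]] Q0 g X by blast
      moreover have "s \<in> T" "t Z \<in> T"
        using s T0 t(1) by (auto simp: level_def)
      ultimately have "comparable lt s (t Z)"
        using forces_mem_comparable[of s "t Z" "(r', x Z)"] r' x by (auto simp: prod_le_def)
      then show ?thesis
        using comparable_levels[OF tree wo _ t(1) d(2)[OF s]] rank[OF \<open>s \<in> T\<close>] by blast
    qed

    \<comment> \<open>Two branches with the same residue and the same node\<close>
    have "range (\<lambda>Z. (m Z, t Z)) \<subseteq> M \<times> level T lt (seg_ord \<delta> d)"
      using m(1) t(1) by blast
    then obtain Z W where ZW: "Z \<noteq> W" "m Z = m W" "t Z = t W"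
      using ex_equal_values_continuum[OF M(1), of "level T lt (seg_ord \<delta> d)" "\<lambda>Z. (m Z, t Z)"]
        assms(4) d(1) by (auto simp: levels_smaller_than_continuum_def)
    obtain k where "k \<in> Z \<longleftrightarrow> k \<notin> W" using ZW by blast
    \<comment> \<open>At stage \<open>n\<close> the sets \<open>Z\<close> and \<open>W\<close>
      already differ, and the condition split there is their common residue.\<close>
    obtain n where n: "n \<ge> k" "u n = m Z" using u_inf m(1) by blast
    have "Z \<inter> {..n} \<noteq> W \<inter> {..n}" using n \<open>k \<in> Z \<longleftrightarrow> k \<notin> W\<close> by auto
    then have "R n (g (Suc n) Z) (g (Suc n) W)" by (rule gR)
    \<comment> \<open>The residue is compatible with \<open>r Z\<close>, which lies below
      \<open>p\<close> and hence below \<open>p0\<close>.\<close>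
    moreover have "compatible E leP (u n) p0"
    proof -
      have "compatible E leP (m Z) (r Z)"
        using m M P_refl by blast
      then show ?thesis
        using n P_trans r p p0 unfolding compatible_def by metis
    qed
    ultimately obtain v v' s s' where "v \<in> M" "v' \<in> M" "s \<in> T0" "s' \<in> T0"
        "leP v (m Z)" "leP v' (m W)" "forces_mem s (v, g (Suc n) Z)" "forces_mem s' (v', g (Suc n) W)"
        "\<not> comparable lt s s'"
      unfolding R_def using n ZW by metis
    moreover from this have "s = t Z \<or> lt s (t Z)" "s' = t Z \<or> lt s' (t Z)"
      using below ZW by metis+
    moreover have "t Z \<in> T" using t(1) by (auto simp: level_def)
    ultimately show False
      using comparable_below[OF tree] T0 by blast
  qed
qed

end
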